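(* Let $f:\{\pm1\}^n\to\mathbb{R}$, let $k\in[n]=\{1,\dots,n\}$, and define $f_{-k}:\{\pm1\}^n\to\mathbb{R}$ by $f_{-k}(x):=f(x_{-k})$, where $x_{-k}(i)=1$ if $i=k$ and $x_{-k}(i)=x(i)$ otherwise. Then, with $X$ uniform on $\{\pm1\}^n$, $$\frac12\,\mathbb{E}_X\big(f(X)-f_{-k}(X)\big)^2=\mathrm{Inf}_k(f).$$
   Context: Every $f:\{\pm1\}^n\to\mathbb{R}$ has the Fourier-Walsh expansion $f(x)=\sum_{T\subseteq[n]}\hat f(T)\chi_T(x)$ with $\chi_T(x)=\prod_{i\in T}x_i$ and $\hat f(T)=2^{-n}\sum_{x\in\{\pm1\}^n}f(x)\chi_T(x)$. The Boolean influence of variable $k\in[n]$ on $f$ is $\mathrm{Inf}_k(f):=\sum_{T\subseteq[n]:\,k\in T}\hat f(T)^2$. *)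

theory Defs
  imports "HOL-Probability.Probability"
begin

text \<open>Points of the cube are extensional functions on \<open>{1..n}\<close>, so that each point has a
  unique representation and the cube is a finite set with \<open>2 ^ n\<close> elements.\<close>

definition cube :: "nat \<Rightarrow> (nat \<Rightarrow> real) set" where
  "cube n = {1..n} \<rightarrow>\<^sub>E {- 1, 1}"

definition walsh :: "nat set \<Rightarrow> (nat \<Rightarrow> real) \<Rightarrow> real" where
  "walsh T x = (\<Prod>i\<in>T. x i)"

definition fourier_coeff :: "nat \<Rightarrow> ((nat \<Rightarrow> real) \<Rightarrow> real) \<Rightarrow> nat set \<Rightarrow> real" where
  "fourier_coeff n f T = (1 / 2 ^ n) * (\<Sum>x\<in>cube n. f x * walsh T x)"

definition influence :: "nat \<Rightarrow> nat \<Rightarrow> ((nat \<Rightarrow> real) \<Rightarrow> real) \<Rightarrow> real" where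
  "influence n k f = (\<Sum>T | T \<subseteq> {1..n} \<and> k \<in> T. (fourier_coeff n f T)\<^sup>2)"

definition set_one :: "nat \<Rightarrow> (nat \<Rightarrow> real) \<Rightarrow> nat \<Rightarrow> real" where
  "set_one k x = (\<lambda>i. if i = k then 1 else x i)"

definition restrict_one :: "nat \<Rightarrow> ((nat \<Rightarrow> real) \<Rightarrow> real) \<Rightarrow> (nat \<Rightarrow> real) \<Rightarrow> real" where
  "restrict_one k f x = f (set_one k x)"

end

theory Submission
  imports Defs
begin

text \<open>Let \<open>g x = f x - f (x with coordinate k flipped)\<close>. Then \<open>f - f\<^sub>-\<^sub>k\<close> agrees with \<open>g\<close> on the half
  of the cube where \<open>x k = -1\<close> and vanishes on the other half, while \<open>g\<^sup>2\<close> is invariant under the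
  flip; so \<open>E (f - f\<^sub>-\<^sub>k)\<^sup>2 = E g\<^sup>2 / 2\<close>. The Fourier coefficient of \<open>g\<close> at \<open>T\<close> is twice that of \<open>f\<close> if
  \<open>k \<in> T\<close> and zero otherwise, so Parseval gives \<open>E g\<^sup>2 = 4 Inf\<^sub>k(f)\<close>.\<close>

definition flip :: "nat \<Rightarrow> (nat \<Rightarrow> real) \<Rightarrow> nat \<Rightarrow> real" where
  "flip k x = x(k := - x k)"

lemma finite_cube [simp]: "finite (cube n)"
  by (simp add: cube_def finite_PiE)

lemma card_cube: "card (cube n) = 2 ^ n"
  by (simp add: cube_def card_PiE numeral_2_eq_2)

lemma cube_nonempty: "cube n \<noteq> {}"
  using card_cube[of n] by auto

lemma cube_cases:
  assumes "x \<in> cube n" "i \<in> {1..n}"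
  shows "x i = - 1 \<or> x i = 1"
  using PiE_mem[of x "{1..n}" "\<lambda>_. {- 1, 1}" i] assms by (simp add: cube_def)

lemma flip_flip [simp]: "flip k (flip k x) = x"
  by (simp add: flip_def)

lemma flip_cube:
  assumes "k \<in> {1..n}" "x \<in> cube n"
  shows "flip k x \<in> cube n"
  unfolding cube_def
proof (rule PiE_I)
  fix i assume "i \<in> {1..n}"
  then show "flip k x i \<in> {- 1, 1}"
    using cube_cases[OF assms(2)] by (fastforce simp: flip_def)
next
  fix i assume "i \<notin> {1..n}"
  \<comment> \<open>Since \<open>k\<close> lies in \<open>{1..n}\<close>, the update at
    \<open>k\<close> leaves the value \<open>undefined\<close> outside the index set intact, so the
    flipped point is still extensional.\<close>
  then show "flip k x i = undefined"
    using assms PiE_arb[of x "{1..n}" "\<lambda>_. {- 1, 1}" i] by (auto simp: flip_def cube_def)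
qed

text \<open>The flip is an involution of the cube, hence its own inverse in the reindexing.\<close>

lemma sum_flip_cube:
  assumes "k \<in> {1..n}"
  shows "(\<Sum>x\<in>cube n. h (flip k x)) = (\<Sum>x\<in>cube n. h x)"
  by (rule sum.reindex_bij_witness[of _ "flip k" "flip k"]) (simp_all add: flip_cube[OF assms])

lemma walsh_flip:
  assumes "finite T"
  shows "walsh T (flip k x) = (if k \<in> T then - walsh T x else walsh T x)"
proof (cases "k \<in> T")
  case True
  have "(\<Prod>i\<in>T - {k}. flip k x i) = (\<Prod>i\<in>T - {k}. x i)"
    by (rule prod.cong) (auto simp: flip_def)
  then show ?thesis
    using True assms by (simp add: walsh_def prod.remove[of T k] flip_def)
next
  case False
  then show ?thesis
    unfolding walsh_def by (auto simp: flip_def intro!: prod.cong)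
qed

lemma prod_add_one_Pow:
  fixes a :: "'a \<Rightarrow> 'b::comm_semiring_1"
  assumes "finite A"
  shows "(\<Prod>i\<in>A. a i + 1) = (\<Sum>T\<in>Pow A. \<Prod>i\<in>T. a i)"
  using prod_add[OF assms, of a "\<lambda>_. 1"] by simp

text \<open>Orthogonality in its dual form: two points are fixed and the sum runs over the
  characters. It factorizes over the coordinates, and each factor \<open>x i * y i + 1\<close> is 2
  where the points agree and 0 where they differ.\<close>

lemma sum_walsh_mult:
  assumes x: "x \<in> cube n" and y: "y \<in> cube n"
  shows "(\<Sum>T\<in>Pow {1..n}. walsh T x * walsh T y) = (if x = y then 2 ^ n else 0)"
proof -
  have "(\<Sum>T\<in>Pow {1..n}. walsh T x * walsh T y) = (\<Prod>i\<in>{1..n}. x i * y i + 1)"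
    by (simp add: walsh_def prod.distrib prod_add_one_Pow)
  also have "\<dots> = (if x = y then 2 ^ n else 0)"
  proof (cases "x = y")
    case True
    have "(\<Prod>i\<in>{1..n}. x i * y i + 1) = (\<Prod>i\<in>{1..n}. 2)"
      using cube_cases[OF y] True by (intro prod.cong) fastforce+
    then show ?thesis using True by simp
  next
    case False
    then obtain i where i: "i \<in> {1..n}" "x i \<noteq> y i"
      using x y unfolding cube_def by (metis PiE_ext)
    then have "x i * y i + 1 = 0"
      using cube_cases[OF x i(1)] cube_cases[OF y i(1)] by auto
    then show ?thesis using False i(1) by (auto simp: prod_zero_iff)
  qed
  finally show ?thesis .
qed

text \<open>Each squared coefficient is a double sum over pairs of points. Moving the sum over
  \<open>T\<close> innermost lets \<open>sum_walsh_mult\<close> kill all pairs off the diagonal, so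
  Fourier inversion is not invoked.\<close>

lemma parseval:
  "(\<Sum>T\<in>Pow {1..n}. (fourier_coeff n g T)\<^sup>2) = (1 / 2 ^ n) * (\<Sum>x\<in>cube n. (g x)\<^sup>2)"
proof -
  have sq: "(fourier_coeff n g T)\<^sup>2 = (1 / 2 ^ n)\<^sup>2 *
      (\<Sum>x\<in>cube n. \<Sum>y\<in>cube n. g x * g y * (walsh T x * walsh T y))" for T
    by (simp add: fourier_coeff_def power2_eq_square sum_product mult_ac)
  have "(\<Sum>T\<in>Pow {1..n}. (fourier_coeff n g T)\<^sup>2) = (1 / 2 ^ n)\<^sup>2 *
      (\<Sum>T\<in>Pow {1..n}. \<Sum>x\<in>cube n. \<Sum>y\<in>cube n. g x * g y * (walsh T x * walsh T y))"
    by (simp only: sq sum_distrib_left)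
  also have "\<dots> = (1 / 2 ^ n)\<^sup>2 *
      (\<Sum>x\<in>cube n. \<Sum>T\<in>Pow {1..n}. \<Sum>y\<in>cube n. g x * g y * (walsh T x * walsh T y))"
    by (subst sum.swap) (rule refl)
  also have "\<dots> = (1 / 2 ^ n)\<^sup>2 *
      (\<Sum>x\<in>cube n. \<Sum>y\<in>cube n. \<Sum>T\<in>Pow {1..n}. g x * g y * (walsh T x * walsh T y))"
    by (intro arg_cong2[of _ _ _ _ "(*)"] refl sum.cong sum.swap)
  also have "\<dots> = (1 / 2 ^ n)\<^sup>2 *
      (\<Sum>x\<in>cube n. \<Sum>y\<in>cube n. if x = y then 2 ^ n * (g x)\<^sup>2 else 0)"
    unfolding sum_distrib_left[symmetric]
    by (intro arg_cong2[of _ _ _ _ "(*)"] refl sum.cong)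
       (simp add: sum_walsh_mult power2_eq_square del: One_nat_def)
  also have "\<dots> = (1 / 2 ^ n) * (\<Sum>x\<in>cube n. (g x)\<^sup>2)"
    by (simp add: sum_distrib_left[symmetric] power2_eq_square)
  finally show ?thesis .
qed

text \<open>A change of variables moves the flip from \<open>f\<close> onto the character, whose
  sign changes exactly when \<open>k \<in> T\<close>; the two terms then double or cancel.\<close>

lemma fourier_coeff_diff_flip:
  assumes "k \<in> {1..n}" "finite T"
  shows "fourier_coeff n (\<lambda>x. f x - f (flip k x)) T = (if k \<in> T then 2 * fourier_coeff n f T else 0)"
proof -
  have "(\<Sum>x\<in>cube n. f (flip k x) * walsh T x)
      = (\<Sum>x\<in>cube n. f x * walsh T (flip k x))"
    using sum_flip_cube[OF assms(1), of "\<lambda>x. f x * walsh T (flip k x)"] by simp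
  then show ?thesis
    by (simp add: fourier_coeff_def left_diff_distrib sum_subtractf walsh_flip[OF assms(2)]
        sum_negf)
qed

lemma sum_diff_flip_eq_influence:
  assumes "k \<in> {1..n}"
  shows "(1 / 2 ^ n) * (\<Sum>x\<in>cube n. (f x - f (flip k x))\<^sup>2) = 4 * influence n k f"
proof -
  have "(1 / 2 ^ n) * (\<Sum>x\<in>cube n. (f x - f (flip k x))\<^sup>2)
      = (\<Sum>T\<in>Pow {1..n}. (fourier_coeff n (\<lambda>x. f x - f (flip k x)) T)\<^sup>2)"
    by (rule parseval[symmetric])
  also have "\<dots> = (\<Sum>T\<in>Pow {1..n}. if k \<in> T then 4 * (fourier_coeff n f T)\<^sup>2 else 0)"
    by (rule sum.cong)
       (auto simp: fourier_coeff_diff_flip[OF assms] power_mult_distrib dest: finite_subset)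
  also have "\<dots> = (\<Sum>T | T \<subseteq> {1..n} \<and> k \<in> T. 4 * (fourier_coeff n f T)\<^sup>2)"
    by (simp add: sum.inter_filter[symmetric])
  finally show ?thesis
    by (simp add: influence_def sum_distrib_left)
qed

text \<open>On the cube, setting coordinate \<open>k\<close> to 1 either changes nothing or is the
  flip.\<close>

lemma diff_restrict_one:
  assumes "x \<in> cube n" "k \<in> {1..n}"
  shows "f x - restrict_one k f x = (if x k = 1 then 0 else f x - f (flip k x))"
proof (cases "x k = 1")
  case True
  then have "set_one k x = x" by (auto simp: set_one_def)
  with True show ?thesis by (simp add: restrict_one_def)
next
  case False
  then have "set_one k x = flip k x"
    using cube_cases[OF assms] by (auto simp: set_one_def flip_def)
  with False show ?thesis by (simp add: restrict_one_def)
qed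

lemma sum_diff_restrict_one:
  assumes k: "k \<in> {1..n}"
  shows "2 * (\<Sum>x\<in>cube n. (f x - restrict_one k f x)\<^sup>2)
    = (\<Sum>x\<in>cube n. (f x - f (flip k x))\<^sup>2)"
proof -
  let ?d = "\<lambda>x. (f x - restrict_one k f x)\<^sup>2"
  \<comment> \<open>Each point is paired with its flip. Exactly one of the two has coordinate
    \<open>k\<close> equal to 1 and contributes 0; the other contributes the squared difference,
    which is symmetric in the pair.\<close>
  have "2 * (\<Sum>x\<in>cube n. ?d x) = (\<Sum>x\<in>cube n. ?d x + ?d (flip k x))"
    by (simp add: sum.distrib sum_flip_cube[OF k, of ?d])
  also have "\<dots> = (\<Sum>x\<in>cube n. (f x - f (flip k x))\<^sup>2)"
  proof (rule sum.cong[OF refl])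
    fix x assume x: "x \<in> cube n"
    have "flip k x k = - x k" by (simp add: flip_def)
    then show "?d x + ?d (flip k x) = (f x - f (flip k x))\<^sup>2"
      using cube_cases[OF x k]
      by (auto simp: diff_restrict_one[OF x k] diff_restrict_one[OF flip_cube[OF k x] k]
          power2_commute)
  qed
  finally show ?thesis .
qed

theorem lemma1:
  fixes n k :: nat and f :: "(nat \<Rightarrow> real) \<Rightarrow> real"
  assumes "k \<in> {1..n}"
  shows "1 / 2 * measure_pmf.expectation (pmf_of_set (cube n))
                   (\<lambda>X. (f X - restrict_one k f X)\<^sup>2)
         = influence n k f"
proof -
  have "measure_pmf.expectation (pmf_of_set (cube n)) (\<lambda>X. (f X - restrict_one k f X)\<^sup>2)
      = (\<Sum>x\<in>cube n. (f x - restrict_one k f x)\<^sup>2) / 2 ^ n"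
    by (simp add: integral_pmf_of_set cube_nonempty card_cube)
  \<comment> \<open>The constants cancel: 1/2 from the statement, 1/2 from the half cube on which
    the difference can be nonzero, and 4 from the doubled coefficients.\<close>
  then show ?thesis
    using sum_diff_restrict_one[OF assms, of f] sum_diff_flip_eq_influence[OF assms, of f]
    by (simp add: field_simps)
qed

end
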